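(* For every $n\ge 1$, $$\sum_{\sigma\in B_n} \mathrm{sign}(\sigma)\, q^{\mathrm{fmaj}(\sigma)} = [2]_{-q}[4]_{q}\cdots[2n]_{(-1)^n q}.$$
   Context: $B_n$ is the hyperoctahedral group of signed permutations of $[n]$, a Coxeter group with generators $s_0=[-1,2,\dots,n]$ and $s_i=[1,\dots,i-1,i+1,i,i+2,\dots,n]$ for $1\le i\le n-1$; $\ell$ denotes Coxeter length with respect to these generators and $\mathrm{sign}(\sigma)=(-1)^{\ell(\sigma)}$. $[n]_q=(1-q^n)/(1-q)$. The flag major index is $\mathrm{fmaj}(\sigma)=2\,\mathrm{maj}(\sigma)+\mathrm{neg}(\sigma)$, where $\mathrm{neg}(\sigma)=\#\{i:\sigma(i)<0\}$ and $\mathrm{maj}(\sigma)$ is the major index of $(\sigma(1),\dots,\sigma(n))$ with respect to the order $-1<-2<\cdots<-n<1<\cdots<n$. *)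

theory Defs
  imports "HOL-Combinatorics.Combinatorics" "HOL-Computational_Algebra.Polynomial"
begin

text \<open>
  A signed permutation of \<open>[n]\<close> is an odd bijection of \<open>{-n, \<dots>, -1, 1, \<dots>, n}\<close>; its window is
  \<open>[\<sigma> 1, \<dots>, \<sigma> n]\<close>. As usual for \<open>permutes\<close>, it is extended by the identity to all integers.
\<close>

definition signed_perms :: "nat \<Rightarrow> (int \<Rightarrow> int) set" where
  "signed_perms n =
     {\<sigma>. \<sigma> permutes ({- int n..int n} - {0}) \<and> (\<forall>i. \<sigma> (- i) = - \<sigma> i)}"

definition cox_gen :: "nat \<Rightarrow> int \<Rightarrow> int" where
  "cox_gen i =
     (if i = 0 then transpose 1 (- 1)
      else transpose (int i) (int i + 1) \<circ> transpose (- int i) (- (int i + 1)))"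

definition cox_word :: "nat list \<Rightarrow> int \<Rightarrow> int" where
  "cox_word w = foldr (\<lambda>i \<tau>. cox_gen i \<circ> \<tau>) w id"

definition cox_length :: "nat \<Rightarrow> (int \<Rightarrow> int) \<Rightarrow> nat" where
  "cox_length n \<sigma> =
     (LEAST k. \<exists>w. length w = k \<and> set w \<subseteq> {0..<n} \<and> cox_word w = \<sigma>)"

definition cox_sign :: "nat \<Rightarrow> (int \<Rightarrow> int) \<Rightarrow> int" where
  "cox_sign n \<sigma> = (- 1) ^ cox_length n \<sigma>"

text \<open>The order \<open>-1 < -2 < \<dots> < -n < 1 < \<dots> < n\<close> on nonzero integers.\<close>

definition flag_less :: "int \<Rightarrow> int \<Rightarrow> bool" where
  "flag_less a b \<longleftrightarrow>
     (a < 0 \<and> 0 < b) \<or> (0 < a \<and> 0 < b \<and> a < b) \<or> (a < 0 \<and> b < 0 \<and> b < a)"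

definition neg_count :: "nat \<Rightarrow> (int \<Rightarrow> int) \<Rightarrow> nat" where
  "neg_count n \<sigma> = card {i \<in> {1..n}. \<sigma> (int i) < 0}"

definition flag_maj :: "nat \<Rightarrow> (int \<Rightarrow> int) \<Rightarrow> nat" where
  "flag_maj n \<sigma> = \<Sum>{i \<in> {1..<n}. flag_less (\<sigma> (int i + 1)) (\<sigma> (int i))}"

definition fmaj :: "nat \<Rightarrow> (int \<Rightarrow> int) \<Rightarrow> nat" where
  "fmaj n \<sigma> = 2 * flag_maj n \<sigma> + neg_count n \<sigma>"

text \<open>
  The division is exact whenever \<open>q \<noteq> 1\<close>, see \<open>q_int_eq_sum\<close> below; in particular it is exact
  in the polynomial ring when \<open>q\<close> is plus or minus the indeterminate.
\<close>

definition q_int :: "nat \<Rightarrow> 'a::idom_divide \<Rightarrow> 'a" where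
  "q_int m q = (1 - q ^ m) div (1 - q)"

lemma q_int_eq_sum:
  assumes "q \<noteq> 1"
  shows "q_int m q = (\<Sum>j<m. q ^ j)"
proof -
  have "1 - q ^ m = (1 - q) * (\<Sum>j<m. q ^ j)"
    by (rule one_diff_power_eq)
  with assms show ?thesis
    by (simp add: q_int_def)
qed

lemma cox_gen_0_window:
  "cox_gen 0 1 = - 1" "2 \<le> j \<Longrightarrow> cox_gen 0 j = j"
  by (auto simp: cox_gen_def transpose_def)

lemma cox_gen_window:
  assumes "1 \<le> i"
  shows "cox_gen i (int i) = int i + 1" "cox_gen i (int i + 1) = int i"
    "1 \<le> j \<Longrightarrow> j \<noteq> int i \<Longrightarrow> j \<noteq> int i + 1 \<Longrightarrow> cox_gen i j = j"
  using assms by (auto simp: cox_gen_def transpose_def)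

lemma cox_gen_in_signed_perms:
  assumes "i < n"
  shows "cox_gen i \<in> signed_perms n"
proof -
  have "cox_gen i permutes ({- int n..int n} - {0})"
    using assms
    by (auto simp: cox_gen_def intro!: permutes_compose permutes_swap_id)
  moreover have "cox_gen i (- j) = - cox_gen i j" for j
    by (auto simp: cox_gen_def transpose_def)
  ultimately show ?thesis
    by (simp add: signed_perms_def)
qed

end

theory Submission
  imports Defs
begin

text \<open>
  The product \<open>c = s\<^bsub>n-1\<^esub> \<cdots> s\<^sub>1 s\<^sub>0\<close> moves every value one step down in the cyclic order
  obtained by closing up \<open>-1 < -2 < \<dots> < -n < 1 < \<dots> < n\<close>. Hence left multiplication by \<open>c\<close> raises
  \<open>fmaj\<close> by exactly one unless the last window entry is \<open>-1\<close>: it either turns \<open>1\<close> into \<open>-n\<close>,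
  which keeps all descents and adds a negative entry, or turns the minimum \<open>-1\<close> at a position
  \<open>p < n\<close> into the maximum \<open>n\<close>, which moves the descent at \<open>p - 1\<close> to \<open>p\<close> and removes a negative
  entry. The last entry of \<open>\<sigma> \<in> B\<^sub>n\<close> determines a unique \<open>k < 2n\<close> with
  \<open>\<sigma> = c\<^sup>k \<circ> \<pi>\<close> and \<open>\<pi> \<in> B\<^bsub>n-1\<^esub>\<close>; then \<open>fmaj \<sigma> = k + fmaj \<pi>\<close> and
  \<open>sign \<sigma> = (-1)\<^bsup>nk\<^esup> sign \<pi>\<close>, so the generating function factors.
\<close>

section \<open>The group of signed permutations\<close>

lemma id_in_signed_perms: "id \<in> signed_perms n"
  by (simp add: signed_perms_def permutes_id)

lemma signed_perms_0: "signed_perms 0 = {id}"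
  by (auto simp: signed_perms_def)

lemma finite_signed_perms: "finite (signed_perms n)"
  by (rule finite_subset[OF _ finite_permutations[of "{- int n..int n} - {0}"]])
     (auto simp: signed_perms_def)

lemma signed_perms_bij: "\<sigma> \<in> signed_perms n \<Longrightarrow> bij \<sigma>"
  by (auto simp: signed_perms_def permutes_bij)

lemma signed_perms_odd: "\<sigma> \<in> signed_perms n \<Longrightarrow> \<sigma> (- i) = - \<sigma> i"
  by (simp add: signed_perms_def)

lemma signed_perms_range:
  assumes "\<sigma> \<in> signed_perms n" "i \<noteq> 0" "\<bar>i\<bar> \<le> int n"
  shows "\<sigma> i \<noteq> 0" "\<bar>\<sigma> i\<bar> \<le> int n"
proof -
  have "i \<in> {- int n..int n} - {0}"
    using assms by auto
  then have "\<sigma> i \<in> {- int n..int n} - {0}"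
    using assms(1) permutes_in_image[of \<sigma> "{- int n..int n} - {0}" i]
    by (simp only: signed_perms_def mem_Collect_eq)
  then show "\<sigma> i \<noteq> 0" "\<bar>\<sigma> i\<bar> \<le> int n"
    by auto
qed

lemma signed_perms_compose:
  "\<sigma> \<in> signed_perms n \<Longrightarrow> \<tau> \<in> signed_perms n \<Longrightarrow> \<sigma> \<circ> \<tau> \<in> signed_perms n"
  by (auto simp: signed_perms_def intro: permutes_compose)

lemma signed_perms_inv:
  assumes "\<sigma> \<in> signed_perms n"
  shows "inv \<sigma> \<in> signed_perms n"
proof -
  have "inv \<sigma> (- i) = - inv \<sigma> i" for i
  proof -
    have "\<sigma> (- inv \<sigma> i) = - i"
      using signed_perms_odd[OF assms] signed_perms_bij[OF assms]
      by (simp add: bij_is_surj surj_f_inv_f)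
    then show ?thesis
      using signed_perms_bij[OF assms] by (metis bij_inv_eq_iff)
  qed
  then show ?thesis
    using assms by (simp add: signed_perms_def permutes_inv)
qed

lemma signed_perms_funpow: "\<sigma> \<in> signed_perms n \<Longrightarrow> \<sigma> ^^ k \<in> signed_perms n"
  by (induction k) (auto intro: id_in_signed_perms signed_perms_compose)

text \<open>Extension by the identity makes B_n literally a subset of B_{n+1}, namely the stabilizer
  of n+1; oddness then fixes -(n+1) as well. The recursion on n thus needs no embedding
  maps.\<close>

lemma signed_perms_Suc_fixing_last:
  "\<sigma> \<in> signed_perms n \<longleftrightarrow> \<sigma> \<in> signed_perms (Suc n) \<and> \<sigma> (int (Suc n)) = int (Suc n)"
proof
  assume "\<sigma> \<in> signed_perms n"
  then show "\<sigma> \<in> signed_perms (Suc n) \<and> \<sigma> (int (Suc n)) = int (Suc n)"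
    by (auto simp: signed_perms_def permutes_not_in elim!: permutes_subset)
next
  assume *: "\<sigma> \<in> signed_perms (Suc n) \<and> \<sigma> (int (Suc n)) = int (Suc n)"
  then have p: "\<sigma> permutes ({- int (Suc n)..int (Suc n)} - {0})"
    and o: "\<And>i. \<sigma> (- i) = - \<sigma> i"
    by (auto simp: signed_perms_def)
  have "\<sigma> x = x"
    if "x \<in> ({- int (Suc n)..int (Suc n)} - {0}) - ({- int n..int n} - {0})" for x
  proof -
    have "x = int (Suc n) \<or> x = - int (Suc n)"
      using that by auto
    then show ?thesis
      using * o[of "int (Suc n)"] by auto
  qed
  then have "\<sigma> permutes ({- int n..int n} - {0})"
    by (intro permutes_superset[OF p]) auto
  then show "\<sigma> \<in> signed_perms n"
    using o by (simp add: signed_perms_def)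
qed

section \<open>The Coxeter sign\<close>

lemma cox_word_Nil [simp]: "cox_word [] = id"
  by (simp add: cox_word_def)

lemma cox_word_Cons [simp]: "cox_word (i # w) = cox_gen i \<circ> cox_word w"
  by (simp add: cox_word_def)

lemma cox_word_append: "cox_word (u @ v) = cox_word u \<circ> cox_word v"
  by (induction u) (simp_all add: comp_assoc)

lemma cox_word_concat_replicate: "cox_word (concat (replicate k w)) = cox_word w ^^ k"
  by (induction k) (simp_all add: cox_word_append)

lemma cox_word_in_signed_perms:
  "set w \<subseteq> {0..<n} \<Longrightarrow> cox_word w \<in> signed_perms n"
  by (induction w) (auto intro: id_in_signed_perms signed_perms_compose cox_gen_in_signed_perms)

text \<open>The projection from B_n to S_n that forgets signs. Fixing the nonpositive integers turns
  it into a permutation of all integers, so that \<open>sign\<close> applies to it.\<close>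

definition abs_perm :: "(int \<Rightarrow> int) \<Rightarrow> int \<Rightarrow> int" where
  "abs_perm \<sigma> x = (if x > 0 then \<bar>\<sigma> x\<bar> else x)"

text \<open>Oddness makes the absolute value of an image independent of the sign of the argument.
  Since absolute values are taken only at positive arguments, \<tau> must also send no positive x to
  0.\<close>

lemma abs_perm_compose:
  assumes "\<sigma> \<in> signed_perms n" "\<tau> \<in> signed_perms n"
  shows "abs_perm (\<sigma> \<circ> \<tau>) = abs_perm \<sigma> \<circ> abs_perm \<tau>"
proof
  fix x
  have "\<tau> 0 = 0"
    using signed_perms_odd[OF assms(2), of 0] by simp
  then have "\<tau> x \<noteq> 0" if "x > 0"
    using signed_perms_bij[OF assms(2)] that by (metis bij_pointE less_irrefl)
  moreover have "\<bar>\<sigma> \<bar>y\<bar>\<bar> = \<bar>\<sigma> y\<bar>" for y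
    using signed_perms_odd[OF assms(1), of y] by (cases "y \<ge> 0") auto
  ultimately show "abs_perm (\<sigma> \<circ> \<tau>) x = (abs_perm \<sigma> \<circ> abs_perm \<tau>) x"
    by (auto simp: abs_perm_def)
qed

lemma abs_perm_cox_gen:
  "abs_perm (cox_gen i) = (if i = 0 then id else transpose (int i) (int i + 1))"
  by (auto simp: abs_perm_def cox_gen_def transpose_def fun_eq_iff)

lemma permutation_signed_perm: "\<sigma> \<in> signed_perms n \<Longrightarrow> permutation \<sigma>"
  by (auto simp: signed_perms_def permutation_permutes)

text \<open>
  The generator \<open>s\<^sub>0\<close> is odd and fixes all absolute values; every other generator is even and
  induces a transposition of absolute values. So the product of the two signs is \<open>-1\<close> on each
  generator.
\<close>

lemma sign_cox_word:
  "permutation (abs_perm (cox_word w)) \<and>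
   sign (cox_word w) * sign (abs_perm (cox_word w)) = (- 1) ^ length w"
proof (induction w)
  case Nil
  have "abs_perm id = id"
    by (auto simp: abs_perm_def)
  then show ?case
    by (simp only: cox_word_Nil) (simp add: permutation_id sign_id flip: id_def)
next
  case (Cons i w)
  \<comment> \<open>The statement fixes no rank; any strict bound on the letters serves as
    one.\<close>
  obtain n where n: "set (i # w) \<subseteq> {0..<n}"
    using finite_nat_set_iff_bounded[of "set (i # w)"] by fastforce
  have g: "cox_gen i \<in> signed_perms n"
    using n by (intro cox_gen_in_signed_perms) auto
  have w: "cox_word w \<in> signed_perms n"
    using n by (intro cox_word_in_signed_perms) auto
  have pg: "permutation (abs_perm (cox_gen i))"
    by (simp add: abs_perm_cox_gen permutation_id permutation_swap_id)
  have sg: "sign (cox_gen i) * sign (abs_perm (cox_gen i)) = - 1"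
    by (subst abs_perm_cox_gen)
       (auto simp: cox_gen_def sign_compose permutation_swap_id sign_swap_id)
  have "sign (cox_word (i # w)) * sign (abs_perm (cox_word (i # w)))
      = (sign (cox_gen i) * sign (abs_perm (cox_gen i)))
        * (sign (cox_word w) * sign (abs_perm (cox_word w)))"
    using pg Cons.IH
    by (simp add: abs_perm_compose[OF g w] sign_compose permutation_signed_perm[OF g]
        permutation_signed_perm[OF w])
  then show ?case
    using sg pg Cons.IH
    by (simp only: cox_word_Cons abs_perm_compose[OF g w] permutation_compose) simp
qed

text \<open>The product of the two signs depends only on the group element, so all words for it, a
  shortest one included, have lengths of the same parity.\<close>

lemma cox_sign_cox_word:
  assumes "set w \<subseteq> {0..<n}"
  shows "cox_sign n (cox_word w) = (- 1) ^ length w"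
proof -
  have "\<exists>v. length v = cox_length n (cox_word w) \<and> set v \<subseteq> {0..<n} \<and> cox_word v = cox_word w"
    unfolding cox_length_def by (rule LeastI_ex) (use assms in blast)
  then obtain v where "length v = cox_length n (cox_word w)" "cox_word v = cox_word w"
    by blast
  then show ?thesis
    using sign_cox_word[of v] sign_cox_word[of w] by (simp add: cox_sign_def)
qed

section \<open>The cyclic shift of the values\<close>

definition flag_shift :: "nat \<Rightarrow> int \<Rightarrow> int" where
  "flag_shift n x =
     (if x = 1 then - int n else if x = - 1 then int n
      else if 2 \<le> x \<and> x \<le> int n then x - 1
      else if - int n \<le> x \<and> x \<le> - 2 then x + 1 else x)"

text \<open>In the induction step the new generator pushes the images -n of 1 and n of -1 out to
  -(n+1) and n+1, and brings the so far fixed n+1 and -(n+1) to n and -n.\<close>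

lemma cox_word_flag_shift: "n \<ge> 1 \<Longrightarrow> cox_word (rev [0..<n]) = flag_shift n"
proof (induction n rule: nat_induct_at_least)
  case base
  show ?case
    by (auto simp: flag_shift_def cox_gen_def transpose_def fun_eq_iff)
next
  case (Suc n)
  have "cox_word (rev [0..<Suc n]) = cox_gen n \<circ> flag_shift n"
    using Suc by simp
  also have "\<dots> = flag_shift (Suc n)"
    using Suc.hyps by (auto simp: flag_shift_def cox_gen_def transpose_def fun_eq_iff)
  finally show ?case .
qed

lemma flag_shift_in_signed_perms: "n \<ge> 1 \<Longrightarrow> flag_shift n \<in> signed_perms n"
  using cox_word_in_signed_perms[of "rev [0..<n]" n] by (simp add: cox_word_flag_shift)

text \<open>The orbit of n runs through n, ..., 1, wraps to -n and continues to -1. It meets each of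
  the 2n values once, and -1 only at k = 2n - 1.\<close>

lemma flag_shift_funpow_last:
  assumes "n \<ge> 1" "k < 2 * n"
  shows "(flag_shift n ^^ k) (int n) = (if k < n then int n - int k else int k - 2 * int n)"
  using assms(2)
proof (induction k)
  case (Suc k)
  then have "(flag_shift n ^^ Suc k) (int n)
      = flag_shift n (if k < n then int n - int k else int k - 2 * int n)"
    by simp
  also have "\<dots> = (if Suc k < n then int n - int (Suc k) else int (Suc k) - 2 * int n)"
    using Suc.prems assms(1) by (auto simp: flag_shift_def)
  finally show ?case .
qed simp

text \<open>The powers of the shift send n+1 to each of the 2(n+1) values exactly once, so they form
  a transversal of the left cosets of its stabilizer B_n.\<close>

lemma bij_betw_flag_shift_decomposition:
  "bij_betw (\<lambda>(k, \<pi>). flag_shift (Suc n) ^^ k \<circ> \<pi>)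
     ({..<2 * Suc n} \<times> signed_perms n) (signed_perms (Suc n))"
proof (rule bij_betw_imageI)
  let ?N = "Suc n"
  let ?c = "flag_shift ?N"
  have c: "?c ^^ k \<in> signed_perms ?N" for k
    by (intro signed_perms_funpow flag_shift_in_signed_perms) simp
  have last: "(?c ^^ k) (int ?N) = (if k < ?N then int ?N - int k else int k - 2 * int ?N)"
    if "k < 2 * ?N" for k
    using that by (intro flag_shift_funpow_last) auto
  show "inj_on (\<lambda>(k, \<pi>). ?c ^^ k \<circ> \<pi>) ({..<2 * ?N} \<times> signed_perms n)"
  proof (rule inj_onI, clarify)
    fix k \<pi> l \<rho>
    assume kl: "k < 2 * ?N" "l < 2 * ?N" and \<pi>: "\<pi> \<in> signed_perms n" and \<rho>: "\<rho> \<in> signed_perms n"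
      and eq: "?c ^^ k \<circ> \<pi> = ?c ^^ l \<circ> \<rho>"
    have "\<pi> (int ?N) = int ?N" "\<rho> (int ?N) = int ?N"
      using \<pi> \<rho> signed_perms_Suc_fixing_last by blast+
    then have "(?c ^^ k) (int ?N) = (?c ^^ l) (int ?N)"
      using fun_cong[OF eq, of "int ?N"] by simp
    then have "k = l"
      using kl by (auto simp only: last split: if_splits)
    moreover from this have "\<pi> = \<rho>"
      using eq signed_perms_bij[OF c[of l]] by (metis \<open>k = l\<close> bij_is_inj fun.inj_map inj_eq)
    ultimately show "k = l \<and> \<pi> = \<rho>" by simp
  qed
  show "(\<lambda>(k, \<pi>). ?c ^^ k \<circ> \<pi>) ` ({..<2 * ?N} \<times> signed_perms n) = signed_perms ?N"
  proof (intro equalityI subsetI)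
    fix \<sigma> assume "\<sigma> \<in> (\<lambda>(k, \<pi>). ?c ^^ k \<circ> \<pi>) ` ({..<2 * ?N} \<times> signed_perms n)"
    then obtain k \<pi> where "\<pi> \<in> signed_perms n" "\<sigma> = ?c ^^ k \<circ> \<pi>"
      by (elim imageE SigmaE) (simp only: prod.case)
    moreover from this have "\<pi> \<in> signed_perms ?N"
      using signed_perms_Suc_fixing_last by blast
    ultimately show "\<sigma> \<in> signed_perms ?N"
      using c signed_perms_compose by blast
  next
    fix \<sigma> assume \<sigma>: "\<sigma> \<in> signed_perms ?N"
    define v where "v = \<sigma> (int ?N)"
    \<comment> \<open>The number of steps from \<open>?N\<close> down to \<open>v\<close> in the
      cyclic order, found by inverting \<open>last\<close>.\<close>
    define k where "k = nat (if v > 0 then int ?N - v else v + 2 * int ?N)"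
    have v: "v \<noteq> 0" "\<bar>v\<bar> \<le> int ?N"
      using signed_perms_range[OF \<sigma>, of "int ?N"] by (auto simp: v_def)
    then have k: "k < 2 * ?N"
      by (auto simp: k_def)
    then have kv: "(?c ^^ k) (int ?N) = v"
      using v by (subst last) (auto simp: k_def)
    define \<pi> where "\<pi> = inv (?c ^^ k) \<circ> \<sigma>"
    have "\<pi> (int ?N) = int ?N"
      using kv signed_perms_bij[OF c[of k]]
      by (simp only: \<pi>_def comp_apply v_def[symmetric] bij_is_inj inv_f_eq)
    moreover have "\<pi> \<in> signed_perms ?N"
      unfolding \<pi>_def by (intro signed_perms_compose signed_perms_inv c \<sigma>)
    ultimately have "\<pi> \<in> signed_perms n"
      using signed_perms_Suc_fixing_last by blast
    moreover have "\<sigma> = ?c ^^ k \<circ> \<pi>"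
      using signed_perms_bij[OF c[of k]]
      by (simp add: \<pi>_def fun_eq_iff bij_is_surj surj_f_inv_f)
    ultimately show "\<sigma> \<in> (\<lambda>(k, \<pi>). ?c ^^ k \<circ> \<pi>) ` ({..<2 * ?N} \<times> signed_perms n)"
      using k by (intro image_eqI[of _ _ "(k, \<pi>)"]) auto
  qed
qed

text \<open>Ensures that the minimum in \<open>cox_length\<close> is attained on all of B_n. Words
  are built recursively from the coset decomposition, whose representatives are powers of a known
  word.\<close>

lemma signed_perm_word_exists:
  "\<sigma> \<in> signed_perms n \<Longrightarrow> \<exists>w. set w \<subseteq> {0..<n} \<and> cox_word w = \<sigma>"
proof (induction n arbitrary: \<sigma>)
  case 0
  then show ?case
    by (auto simp: signed_perms_0)
next
  case (Suc n)
  then obtain k \<pi> where \<pi>: "\<pi> \<in> signed_perms n" and \<sigma>: "\<sigma> = flag_shift (Suc n) ^^ k \<circ> \<pi>"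
    using bij_betw_imp_surj_on[OF bij_betw_flag_shift_decomposition[of n]] by force
  from Suc.IH[OF \<pi>] obtain w where w: "set w \<subseteq> {0..<n}" "cox_word w = \<pi>"
    by blast
  let ?w = "concat (replicate k (rev [0..<Suc n])) @ w"
  have "cox_word ?w = \<sigma>"
    using w \<sigma> cox_word_flag_shift[of "Suc n", OF Suc_leI[OF zero_less_Suc, folded One_nat_def]]
    by (simp only: cox_word_append cox_word_concat_replicate)
  moreover have "set ?w \<subseteq> {0..<Suc n}"
    using w by auto
  ultimately show ?case by blast
qed

text \<open>Each factor \<open>flag_shift (Suc n)\<close> costs \<open>Suc n\<close> letters. A word
  for \<pi> with letters below n gives its sign in either rank.\<close>

lemma cox_sign_flag_shift_decomposition:
  assumes "\<pi> \<in> signed_perms n"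
  shows "cox_sign (Suc n) (flag_shift (Suc n) ^^ k \<circ> \<pi>) = ((- 1) ^ Suc n) ^ k * cox_sign n \<pi>"
proof -
  obtain w where w: "set w \<subseteq> {0..<n}" "cox_word w = \<pi>"
    using signed_perm_word_exists[OF assms] by blast
  let ?w = "concat (replicate k (rev [0..<Suc n])) @ w"
  have word: "cox_word ?w = flag_shift (Suc n) ^^ k \<circ> \<pi>"
    using w cox_word_flag_shift[of "Suc n", OF Suc_leI[OF zero_less_Suc, folded One_nat_def]]
    by (simp only: cox_word_append cox_word_concat_replicate)
  have sub: "set ?w \<subseteq> {0..<Suc n}"
    using w by auto
  have len: "length ?w = Suc n * k + length w"
    by (simp add: length_concat sum_list_replicate algebra_simps)
  have "cox_sign (Suc n) (flag_shift (Suc n) ^^ k \<circ> \<pi>) = (- 1) ^ length ?w"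
    using cox_sign_cox_word[OF sub] by (simp only: word)
  also have "\<dots> = ((- 1) ^ Suc n) ^ k * (- 1) ^ length w"
    by (simp only: len power_add power_mult)
  also have "(- 1) ^ length w = cox_sign n \<pi>"
    using cox_sign_cox_word[OF w(1)] w(2) by simp
  finally show ?thesis .
qed

section \<open>The flag major index under the shift\<close>

text \<open>Only -1 changes its relative position: the least value becomes the greatest one,
  n.\<close>

lemma flag_less_flag_shift:
  assumes "a \<noteq> 0" "\<bar>a\<bar> \<le> int n" "b \<noteq> 0" "\<bar>b\<bar> \<le> int n" "a \<noteq> - 1" "b \<noteq> - 1"
  shows "flag_less (flag_shift n a) (flag_shift n b) = flag_less a b"
  using assms by (auto simp: flag_less_def flag_shift_def)

lemma fmaj_flag_shift:
  assumes \<sigma>: "\<sigma> \<in> signed_perms n" and n: "n \<ge> 1" and last: "\<sigma> (int n) \<noteq> - 1"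
  shows "fmaj n (flag_shift n \<circ> \<sigma>) = Suc (fmaj n \<sigma>)"
proof -
  let ?c = "flag_shift n"
  have inj: "\<sigma> x = \<sigma> y \<longleftrightarrow> x = y" for x y
    using signed_perms_bij[OF \<sigma>] by (meson bij_is_inj inj_eq)
  have rng: "\<sigma> (int i) \<noteq> 0" "\<bar>\<sigma> (int i)\<bar> \<le> int n" if "i \<in> {1..n}" for i
    using signed_perms_range[OF \<sigma>, of "int i"] that by auto
  \<comment> \<open>Only the entry 1 or -1 can change its sign or its order relations under the
    shift; \<open>p\<close> is its position in the window.\<close>
  obtain p where p: "p \<in> {1..n}" "\<bar>\<sigma> (int p)\<bar> = 1"
  proof -
    have i: "inv \<sigma> 1 \<noteq> 0" "\<bar>inv \<sigma> 1\<bar> \<le> int n"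
      using signed_perms_range[OF signed_perms_inv[OF \<sigma>], of 1] n by auto
    have "\<sigma> (inv \<sigma> 1) = 1"
      using signed_perms_bij[OF \<sigma>] by (simp add: bij_is_surj surj_f_inv_f)
    then have "\<bar>\<sigma> \<bar>inv \<sigma> 1\<bar>\<bar> = 1"
      using signed_perms_odd[OF \<sigma>, of "inv \<sigma> 1"] by (cases "inv \<sigma> 1 \<ge> 0") auto
    then show thesis
      using i by (intro that[of "nat \<bar>inv \<sigma> 1\<bar>"]) auto
  qed
  have other: "\<bar>\<sigma> (int i)\<bar> \<noteq> 1" if "i \<in> {1..n}" "i \<noteq> p" for i
  proof
    assume "\<bar>\<sigma> (int i)\<bar> = 1"
    then have "\<sigma> (int i) = \<sigma> (int p) \<or> \<sigma> (int i) = - \<sigma> (int p)"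
      using p(2) by linarith
    then have "\<sigma> (int i) = \<sigma> (int p) \<or> \<sigma> (int i) = \<sigma> (- int p)"
      using signed_perms_odd[OF \<sigma>] by simp
    then show False
      using that p(1) by (auto simp: inj)
  qed
  define D where "D = {i \<in> {1..<n}. flag_less (\<sigma> (int i + 1)) (\<sigma> (int i))}"
  define D' where "D' = {i \<in> {1..<n}. flag_less (?c (\<sigma> (int i + 1))) (?c (\<sigma> (int i)))}"
  define E where "E = {i \<in> {1..n}. \<sigma> (int i) < 0}"
  define E' where "E' = {i \<in> {1..n}. ?c (\<sigma> (int i)) < 0}"
  have fin: "finite D" "finite D'" "finite E" "finite E'"
    by (auto simp: D_def D'_def E_def E'_def)
  have fmaj: "fmaj n \<sigma> = 2 * \<Sum>D + card E" "fmaj n (?c \<circ> \<sigma>) = 2 * \<Sum>D' + card E'"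
    by (simp_all add: fmaj_def flag_maj_def neg_count_def D_def D'_def E_def E'_def)
  have rng1: "\<sigma> (int i + 1) \<noteq> 0" "\<bar>\<sigma> (int i + 1)\<bar> \<le> int n" if "i \<in> {1..<n}" for i
    using rng[of "Suc i"] that by (auto simp: add.commute)
  have other1: "\<bar>\<sigma> (int i + 1)\<bar> \<noteq> 1" if "i \<in> {1..<n}" "Suc i \<noteq> p" for i
    using other[of "Suc i"] that by (auto simp: add.commute)
  have neg: "?c (\<sigma> (int i)) < 0 \<longleftrightarrow> \<sigma> (int i) < 0" if "i \<in> {1..n}" "i \<noteq> p" for i
    using other[OF that] rng[OF that(1)] by (auto simp: flag_shift_def)
  show ?thesis
  proof (cases "\<sigma> (int p) = 1")
    case True
    have m1: "\<sigma> (int i) \<noteq> - 1" if "i \<in> {1..n}" for i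
      using other[OF that] True by (cases "i = p") auto
    have "\<sigma> (int i + 1) \<noteq> - 1" if "i \<in> {1..<n}" for i
      using m1[of "Suc i"] that by (auto simp: add.commute)
    then have "D' = D"
      using m1 rng rng1 by (auto simp: D_def D'_def flag_less_flag_shift)
    moreover have "?c (\<sigma> (int p)) < 0"
      using True n by (simp add: flag_shift_def)
    then have "E' = insert p E"
      using p(1) neg unfolding E_def E'_def by blast
    moreover have "p \<notin> E"
      using True by (simp add: E_def)
    ultimately show ?thesis
      using fin by (simp add: fmaj)
  next
    case False
    then have m1: "\<sigma> (int p) = - 1"
      using p(2) by linarith
    then have "p \<noteq> n"
      using last by auto
    then have pn: "p \<in> {1..<n}"
      using p(1) by auto
    have "\<not> ?c (\<sigma> (int p)) < 0" "\<sigma> (int p) < 0"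
      using m1 by (simp_all add: flag_shift_def)
    then have "E = insert p E'" "p \<notin> E'"
      using p(1) neg unfolding E_def E'_def by blast+
    then have cE: "card E = Suc (card E')"
      using fin by simp
    \<comment> \<open>The entry at \<open>p\<close> takes part only in the comparisons at positions
      \<open>p - 1\<close> and \<open>p\<close>.\<close>
    have same: "i \<in> D' \<longleftrightarrow> i \<in> D" if "i \<noteq> p" "Suc i \<noteq> p" for i
    proof (cases "i \<in> {1..<n}")
      case True
      then have "\<sigma> (int i) \<noteq> - 1" "\<sigma> (int i + 1) \<noteq> - 1"
        using other[of i] other1[of i] that by auto
      then show ?thesis
        using True rng[of i] rng1[of i] by (auto simp: D_def D'_def flag_less_flag_shift)
    qed (auto simp: D_def D'_def)
    have pD: "p \<notin> D" "p \<in> D'"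
      using pn m1 rng1[OF pn] other1[OF pn]
      by (auto simp: D_def D'_def flag_less_def flag_shift_def)
    have "\<Sum>D' = Suc (\<Sum>D)"
    \<comment> \<open>For \<open>p = 1\<close> no descent precedes \<open>p\<close>, so the descent
      at 1 is simply gained, which again adds 1 to the sum.\<close>
    proof (cases "p = 1")
      case True
      then have "Suc i = p \<Longrightarrow> i \<notin> D \<and> i \<notin> D'" for i
        by (auto simp: D_def D'_def)
      then have "D' = insert p D"
        using same pD by (intro set_eqI) (metis insert_iff)
      then show ?thesis
        using True pD fin by simp
    next
      case False
      define r where "r = p - 1"
      have r: "Suc r = p" "r \<in> {1..<n}" "r \<noteq> p"
        using False pn by (auto simp: r_def)
      have rp: "\<sigma> (int r + 1) = - 1"
        using m1 r(1) by (auto simp: add.commute)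
      have rD: "r \<in> D" "r \<notin> D'"
        using r rp rng[of r] other[of r]
        by (auto simp: D_def D'_def flag_less_def flag_shift_def)
      have "D' = insert p (D - {r})"
      proof (rule set_eqI)
        fix i
        consider "i = p" | "i = r" | "i \<noteq> p" "Suc i \<noteq> p" "i \<noteq> r"
          using r(1) by blast
        then show "i \<in> D' \<longleftrightarrow> i \<in> insert p (D - {r})"
          using same pD rD r(3) by cases auto
      qed
      then have "\<Sum>D' = p + \<Sum>(D - {r})"
        using pD fin by simp
      moreover have "\<Sum>D = r + \<Sum>(D - {r})"
        using rD fin by (simp add: sum.remove)
      ultimately show ?thesis
        using r(1) by simp
    qed
    \<comment> \<open>The major index grows by 1 and one negative entry is lost, a net change of 2 -
      1.\<close>
    then show ?thesis
      using cE by (simp add: fmaj)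
  qed
qed

text \<open>The appended entry n+1 is positive and the greatest, so it creates neither a negative
  entry nor a descent at n.\<close>

lemma fmaj_Suc:
  assumes "\<pi> \<in> signed_perms n"
  shows "fmaj (Suc n) \<pi> = fmaj n \<pi>"
proof -
  have last: "\<pi> (int n + 1) = int n + 1"
    using assms signed_perms_Suc_fixing_last[of \<pi> n] by (simp add: add.commute)
  have "\<not> flag_less (\<pi> (int n + 1)) (\<pi> (int n))" if "n \<ge> 1"
    using signed_perms_range[OF assms, of "int n"] that by (auto simp: last flag_less_def)
  then have "{i \<in> {1..<Suc n}. flag_less (\<pi> (int i + 1)) (\<pi> (int i))}
      = {i \<in> {1..<n}. flag_less (\<pi> (int i + 1)) (\<pi> (int i))}"
    by (auto simp: less_Suc_eq)
  moreover have "{i \<in> {1..Suc n}. \<pi> (int i) < 0} = {i \<in> {1..n}. \<pi> (int i) < 0}"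
    using last by (auto simp: le_Suc_eq add.commute)
  ultimately show ?thesis
    by (simp add: fmaj_def flag_maj_def neg_count_def)
qed

lemma fmaj_flag_shift_decomposition:
  assumes "\<pi> \<in> signed_perms n" "k < 2 * Suc n"
  shows "fmaj (Suc n) (flag_shift (Suc n) ^^ k \<circ> \<pi>) = k + fmaj n \<pi>"
  using assms(2)
proof (induction k)
  case 0
  then show ?case
    using fmaj_Suc[OF assms(1)] by simp
next
  case (Suc k)
  let ?c = "flag_shift (Suc n)"
  have \<pi>: "\<pi> \<in> signed_perms (Suc n)" "\<pi> (int (Suc n)) = int (Suc n)"
    using assms(1) signed_perms_Suc_fixing_last by blast+
  have "?c ^^ k \<circ> \<pi> \<in> signed_perms (Suc n)"
    by (intro signed_perms_compose signed_perms_funpow flag_shift_in_signed_perms \<pi>) simp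
  \<comment> \<open>The value -1 would require \<open>k = 2 * Suc n - 1\<close>, but
    \<open>Suc k\<close> is still below \<open>2 * Suc n\<close>.\<close>
  moreover have "(?c ^^ k \<circ> \<pi>) (int (Suc n)) \<noteq> - 1"
    using Suc.prems flag_shift_funpow_last[of "Suc n" k] \<pi>(2) by auto
  ultimately have "fmaj (Suc n) (?c \<circ> (?c ^^ k \<circ> \<pi>)) = Suc (fmaj (Suc n) (?c ^^ k \<circ> \<pi>))"
    by (intro fmaj_flag_shift) auto
  then show ?case
    using Suc.IH Suc.prems by (simp only: funpow.simps comp_assoc)
qed

section \<open>The signed generating function\<close>

text \<open>Along the coset decomposition the sign is multiplicative and \<open>fmaj\<close>
  additive, so each term splits into a power indexed by k and the term of \<pi>.\<close>

lemma signed_fmaj_sum_Suc: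
  fixes q :: "'a::comm_ring_1"
  shows "(\<Sum>\<sigma>\<in>signed_perms (Suc n). of_int (cox_sign (Suc n) \<sigma>) * q ^ fmaj (Suc n) \<sigma>)
       = (\<Sum>\<sigma>\<in>signed_perms n. of_int (cox_sign n \<sigma>) * q ^ fmaj n \<sigma>)
         * (\<Sum>k<2 * Suc n. ((- 1) ^ Suc n * q) ^ k)"
proof -
  have "(\<Sum>\<sigma>\<in>signed_perms (Suc n). of_int (cox_sign (Suc n) \<sigma>) * q ^ fmaj (Suc n) \<sigma>)
      = (\<Sum>(k, \<pi>)\<in>{..<2 * Suc n} \<times> signed_perms n.
          of_int (cox_sign (Suc n) (flag_shift (Suc n) ^^ k \<circ> \<pi>))
          * q ^ fmaj (Suc n) (flag_shift (Suc n) ^^ k \<circ> \<pi>))"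
    by (subst sum.reindex_bij_betw[OF bij_betw_flag_shift_decomposition, symmetric])
       (simp add: case_prod_unfold)
  also have "\<dots> = (\<Sum>(k, \<pi>)\<in>{..<2 * Suc n} \<times> signed_perms n.
      ((- 1) ^ Suc n * q) ^ k * (of_int (cox_sign n \<pi>) * q ^ fmaj n \<pi>))"
  proof (rule sum.cong, simp, clarify)
    fix k \<pi> assume *: "k < 2 * Suc n" "\<pi> \<in> signed_perms n"
    show "of_int (cox_sign (Suc n) (flag_shift (Suc n) ^^ k \<circ> \<pi>))
          * q ^ fmaj (Suc n) (flag_shift (Suc n) ^^ k \<circ> \<pi>)
        = ((- 1) ^ Suc n * q) ^ k * (of_int (cox_sign n \<pi>) * q ^ fmaj n \<pi>)"
      unfolding fmaj_flag_shift_decomposition[OF *(2,1)] cox_sign_flag_shift_decomposition[OF *(2)]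
        of_int_mult of_int_power of_int_minus of_int_1 power_add power_mult_distrib
      by (simp only: mult_ac)
  qed
  also have "\<dots> = (\<Sum>k<2 * Suc n. ((- 1) ^ Suc n * q) ^ k)
      * (\<Sum>\<pi>\<in>signed_perms n. of_int (cox_sign n \<pi>) * q ^ fmaj n \<pi>)"
    by (simp only: sum_product sum.cartesian_product)
  finally show ?thesis
    by (simp only: mult.commute)
qed

theorem theorem5p1:
  fixes n :: nat and q :: "int poly"
  assumes "n \<ge> 1" and "q = [:0, 1:]"
  shows "(\<Sum>\<sigma>\<in>signed_perms n. of_int (cox_sign n \<sigma>) * q ^ fmaj n \<sigma>)
         = (\<Prod>i=1..n. q_int (2 * i) ((- 1) ^ i * q))"
proof -
  \<comment> \<open>This makes each \<open>q_int\<close> factor a genuine geometric sum: plus or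
    minus the indeterminate is never the constant 1.\<close>
  have ne: "(- 1) ^ i * q \<noteq> 1" for i :: nat
    using assms(2) by (cases "even i") (auto simp: one_pCons)
  show ?thesis
  proof (induction n)
    case 0
    have "cox_sign 0 id = 1"
      using cox_sign_cox_word[of "[]" 0] by (simp only: cox_word_Nil) simp
    then show ?case
      by (simp add: id_def signed_perms_0 fmaj_def flag_maj_def neg_count_def)
  next
    case (Suc n)
    show ?case
      unfolding signed_fmaj_sum_Suc Suc.IH
      using q_int_eq_sum[OF ne[of "Suc n"], of "2 * Suc n"] by simp
  qed
qed

end
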